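(* For every integer $n\geq 4$, $\chi_{td}(W_n)=\chi_{td}(K_{1,n-1})$ except when $n$ is $4$ or $5$. Explicitly, $$\chi_{td}(W_n)=\begin{cases} 8 & n=4,\\ 7 & n=5,\\ n+1 & n \text{ even and } n\geq 6,\\ n & n\text{ odd and } n\geq 7.\end{cases}$$
   Context: Graphs are finite, simple and undirected. $K_{1,m}$ is the star with $m$ leaves. For $n\geq 4$, the wheel $W_n$ is the graph on $n$ vertices obtained from the cycle $C_{n-1}$ on $n-1$ vertices by adding one vertex adjacent to all vertices of the cycle. A total labeling of a graph $G$ is a function $f:V(G)\cup E(G)\to\mathbb{Z}^+$ (positive integers) such that $f(u)\neq f(v)$ for adjacent vertices $u,v$; $f(\{u,v\})\neq f(\{v,w\})$ for any two distinct incident edges $\{u,v\},\{v,w\}$; and $f(u)\neq f(\{u,v\})$ for every edge $\{u,v\}$ and incident vertex $u$. It is a $k$-total labeling if the maximum label assigned to any vertex or edge is $k$. A $k$-total difference labeling is a $k$-total labeling $f$ with $f(\{u,v\})=|f(u)-f(v)|$ for every edge $\{u,v\}$. The total difference chromatic number $\chi_{td}(G)$ is the smallest integer $k$ for which $G$ has a $k$-total difference labeling. *)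

theory Defs
  imports Main
begin

record 'a ugraph =
  verts :: "'a set"
  edges :: "'a set set"

definition simple_graph :: "'a ugraph \<Rightarrow> bool" where
  "simple_graph G \<longleftrightarrow> finite (verts G) \<and> (\<forall>e\<in>edges G. e \<subseteq> verts G \<and> card e = 2)"

definition cycle_graph :: "nat \<Rightarrow> nat ugraph" where
  "cycle_graph m = \<lparr>verts = {..<m}, edges = {{i, (i + 1) mod m} |i. i < m}\<rparr>"

text \<open>The leaves are \<open>0, \<dots>, m - 1\<close> and the centre is \<open>m\<close>.\<close>

definition star_graph :: "nat \<Rightarrow> nat ugraph" where
  "star_graph m = \<lparr>verts = {..m}, edges = {{i, m} |i. i < m}\<rparr>"

text \<open>The subscript of the wheel counts all vertices: the rim is the cycle on
  \<open>0, \<dots>, n - 2\<close> and the hub is \<open>n - 1\<close>.  Meaningful for \<open>n \<ge> 4\<close>.\<close>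

definition wheel_graph :: "nat \<Rightarrow> nat ugraph" where
  "wheel_graph n =
    \<lparr>verts = insert (n - 1) (verts (cycle_graph (n - 1))),
     edges = edges (cycle_graph (n - 1)) \<union> {{v, n - 1} |v. v \<in> verts (cycle_graph (n - 1))}\<rparr>"

text \<open>A labeling of \<open>V(G) \<union> E(G)\<close> is a function on the disjoint sum: \<open>Inl v\<close> is the vertex \<open>v\<close>
  and \<open>Inr e\<close> is the edge \<open>e\<close>.  Values outside \<open>verts G <+> edges G\<close> are irrelevant.\<close>

definition total_labeling :: "'a ugraph \<Rightarrow> ('a + 'a set \<Rightarrow> nat) \<Rightarrow> bool" where
  "total_labeling G f \<longleftrightarrow>
     (\<forall>x \<in> verts G <+> edges G. 0 < f x) \<and>
     (\<forall>u v. {u, v} \<in> edges G \<longrightarrow> f (Inl u) \<noteq> f (Inl v)) \<and>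
     (\<forall>u v w. {u, v} \<in> edges G \<and> {v, w} \<in> edges G \<and> {u, v} \<noteq> {v, w} \<longrightarrow>
        f (Inr {u, v}) \<noteq> f (Inr {v, w})) \<and>
     (\<forall>u v. {u, v} \<in> edges G \<longrightarrow> f (Inl u) \<noteq> f (Inr {u, v}))"

definition k_total_labeling :: "nat \<Rightarrow> 'a ugraph \<Rightarrow> ('a + 'a set \<Rightarrow> nat) \<Rightarrow> bool" where
  "k_total_labeling k G f \<longleftrightarrow> total_labeling G f \<and> Max (f ` (verts G <+> edges G)) = k"

definition k_total_difference_labeling :: "nat \<Rightarrow> 'a ugraph \<Rightarrow> ('a + 'a set \<Rightarrow> nat) \<Rightarrow> bool" where
  "k_total_difference_labeling k G f \<longleftrightarrow> k_total_labeling k G f \<and>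
     (\<forall>u v. {u, v} \<in> edges G \<longrightarrow>
        int (f (Inr {u, v})) = \<bar>int (f (Inl u)) - int (f (Inl v))\<bar>)"

definition total_difference_chromatic_number :: "'a ugraph \<Rightarrow> nat" (\<open>\<chi>\<^sub>t\<^sub>d\<close>) where
  "total_difference_chromatic_number G = (LEAST k. \<exists>f. k_total_difference_labeling k G f)"

lemma simple_graph_star: "simple_graph (star_graph m)"
  by (auto simp: simple_graph_def star_graph_def card_insert_if)

lemma simple_graph_cycle:
  assumes "3 \<le> m" shows "simple_graph (cycle_graph m)"
proof -
  have "(i + 1) mod m < m \<and> i \<noteq> (i + 1) mod m" if "i < m" for i
    using assms that by (cases "i + 1 = m") auto
  then show ?thesis
    by (auto simp: simple_graph_def cycle_graph_def card_insert_if)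
qed

lemma simple_graph_wheel:
  assumes "4 \<le> n" shows "simple_graph (wheel_graph n)"
proof -
  have "simple_graph (cycle_graph (n - 1))"
    using assms by (intro simple_graph_cycle) simp
  moreover have "n - 1 \<notin> verts (cycle_graph (n - 1))"
    by (simp add: cycle_graph_def)
  ultimately show ?thesis
    by (auto simp: simple_graph_def wheel_graph_def card_insert_if)
qed

end

theory Submission
  imports Defs
begin

text \<open>
  Edge labels of a total difference labeling are determined by the vertex labels, so everything
  can be phrased for vertex labels: adjacent labels are distinct and neither is twice the other,
  and the labels along a path of length two are distinct and do not form an arithmetic progression.

  In a star all labels are then distinct.  If \<open>n\<close> is even and only \<open>1, \<dots>, n\<close> are used, all of them
  occur, and there is no room for the hub label \<open>h\<close>: \<open>h = 1\<close> conflicts with \<open>2\<close>, \<open>h = n\<close> with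
  \<open>n / 2\<close>, and any other \<open>h\<close> lies halfway between \<open>h - 1\<close> and \<open>h + 1\<close>.

  For the wheel with \<open>n \<ge> 8\<close> put \<open>t = \<lfloor>n / 2\<rfloor>\<close>, give the hub the label \<open>2 t + 1\<close> and
  label the rim by \<open>1, t + 3, 2, t + 4, \<dots>, t - 2, 2 t, t - 1, t + 1, t, t + 2\<close>, dropping
  the last entry if \<open>n\<close> is even.  Low and high labels alternate, so three consecutive
  rim labels are never in progression; the shift by \<open>t + 2\<close> between low and high labels avoids the
  doublings \<open>y = 2 x\<close> and the progressions through the hub label.
  The wheels with \<open>n \<le> 7\<close> are settled by explicit labels and, for \<open>n \<le> 5\<close>, an exhaustive
  search for the lower bound.
\<close>

section \<open>Labelings as vertex colorings\<close>

text \<open>One direction of the doubling ban suffices, since \<open>{u, v} = {v, u}\<close>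
  supplies the other.\<close>

definition difference_coloring :: "'a ugraph \<Rightarrow> ('a \<Rightarrow> nat) \<Rightarrow> bool" where
  "difference_coloring G c \<longleftrightarrow>
     (\<forall>v\<in>verts G. 0 < c v) \<and>
     (\<forall>u v. {u, v} \<in> edges G \<longrightarrow> c u \<noteq> c v \<and> c u \<noteq> 2 * c v) \<and>
     (\<forall>u v w. {u, v} \<in> edges G \<and> {v, w} \<in> edges G \<and> u \<noteq> w \<longrightarrow>
        c u \<noteq> c w \<and> c u + c w \<noteq> 2 * c v)"

lemma difference_coloring_pos:
  "difference_coloring G c \<Longrightarrow> v \<in> verts G \<Longrightarrow> 0 < c v"
  by (simp add: difference_coloring_def)

lemma difference_coloring_edge:
  assumes "difference_coloring G c" "{u, v} \<in> edges G"
  shows "c u \<noteq> c v" "c u \<noteq> 2 * c v" "c v \<noteq> 2 * c u"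
  using assms unfolding difference_coloring_def by (metis insert_commute)+

lemma difference_coloring_path:
  assumes "difference_coloring G c" "{u, v} \<in> edges G" "{v, w} \<in> edges G" "u \<noteq> w"
  shows "c u \<noteq> c w" "c u + c w \<noteq> 2 * c v"
  using assms unfolding difference_coloring_def by blast+

lemma difference_coloring_mono:
  assumes "difference_coloring G c" "verts H \<subseteq> verts G" "edges H \<subseteq> edges G"
  shows "difference_coloring H c"
  using assms unfolding difference_coloring_def by (meson subsetD)

text \<open>For positive labels, the edge label |a - b| equals b exactly if a = 2 b; the edges from
  a vertex labeled b to vertices labeled a and c agree exactly if a = c or a + c = 2 b.\<close>

lemma difference_coloring_of_labeling:
  assumes f: "k_total_difference_labeling k G f"
  shows "difference_coloring G (f \<circ> Inl)"
proof -
  have tl: "total_labeling G f"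
    and diff: "\<And>u v. {u, v} \<in> edges G \<Longrightarrow>
      int (f (Inr {u, v})) = \<bar>int (f (Inl u)) - int (f (Inl v))\<bar>"
    using f by (auto simp: k_total_difference_labeling_def k_total_labeling_def)
  have "0 < f (Inl v)" if "v \<in> verts G" for v
    using tl that by (auto simp: total_labeling_def)
  moreover have "f (Inl u) \<noteq> f (Inl v) \<and> f (Inl u) \<noteq> 2 * f (Inl v)" if e: "{u, v} \<in> edges G" for u v
  proof -
    \<comment> \<open>An edge is compared only with its first listed end; reversing it gives the
      comparison with \<open>v\<close>.\<close>
    have "{v, u} \<in> edges G" using e by (simp add: insert_commute)
    then have "f (Inl u) \<noteq> f (Inl v)" "f (Inl v) \<noteq> f (Inr {v, u})"
      using tl e by (auto simp: total_labeling_def)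
    then show ?thesis using diff[OF e] by (auto simp: insert_commute)
  qed
  moreover have "f (Inl u) \<noteq> f (Inl w) \<and> f (Inl u) + f (Inl w) \<noteq> 2 * f (Inl v)"
    if e: "{u, v} \<in> edges G" "{v, w} \<in> edges G" "u \<noteq> w" for u v w
  proof -
    have "{u, v} \<noteq> {v, w}" using e(3) by (auto simp: doubleton_eq_iff)
    then have "f (Inr {u, v}) \<noteq> f (Inr {v, w})"
      using tl e unfolding total_labeling_def by blast
    then show ?thesis using diff[OF e(1)] diff[OF e(2)] by auto
  qed
  ultimately show ?thesis by (auto simp: difference_coloring_def)
qed

text \<open>Differences of positive labels bounded by \<open>k\<close> stay below \<open>k\<close>,
  so the maximum is attained at a vertex.\<close>

lemma labeling_of_difference_coloring:
  assumes G: "simple_graph G" and c: "difference_coloring G c"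
    and max: "k \<in> c ` verts G" "\<And>v. v \<in> verts G \<Longrightarrow> c v \<le> k"
  shows "\<exists>f. k_total_difference_labeling k G f"
proof -
  \<comment> \<open>\<open>Max\<close> minus \<open>Min\<close> is the absolute difference as a
    function of the unordered edge, with no order of its ends to choose.\<close>
  define f where "f = case_sum c (\<lambda>e. Max (c ` e) - Min (c ` e))"
  have fe: "f (Inr {u, v}) = max (c u) (c v) - min (c u) (c v)" for u v
    by (simp add: f_def)
  have edge: "\<exists>u v. e = {u, v} \<and> u \<in> verts G \<and> v \<in> verts G" if "e \<in> edges G" for e
    using G that unfolding simple_graph_def card_2_iff by (metis insert_subset)
  have fin: "finite (verts G <+> edges G)"
  proof -
    have "edges G \<subseteq> Pow (verts G)" "finite (verts G)"
      using G by (auto simp: simple_graph_def)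
    then show ?thesis by (meson finite_Plus finite_Pow_iff finite_subset)
  qed
  have "Max (f ` (verts G <+> edges G)) = k"
  proof (rule Max_eqI)
    show "finite (f ` (verts G <+> edges G))" using fin by simp
    show "k \<in> f ` (verts G <+> edges G)"
      using max(1) by (force simp: f_def image_iff)
    fix y assume "y \<in> f ` (verts G <+> edges G)"
    then consider v where "v \<in> verts G" "y = c v" | e where "e \<in> edges G" "y = f (Inr e)"
      by (auto simp: f_def)
    then show "y \<le> k"
    proof cases
      case 1
      then show ?thesis using max(2) by simp
    next
      case 2
      obtain u v where uv: "e = {u, v}" "u \<in> verts G" "v \<in> verts G" using edge[OF 2(1)] by blast
      then show ?thesis using 2(2) fe[of u v] max(2)[of u] max(2)[of v] by auto
    qed
  qed
  moreover have "total_labeling G f"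
    unfolding total_labeling_def
  proof (intro conjI allI impI ballI)
    fix x assume "x \<in> verts G <+> edges G"
    then consider v where "v \<in> verts G" "x = Inl v" | e where "e \<in> edges G" "x = Inr e"
      by auto
    then show "0 < f x"
    proof cases
      case 1
      then show ?thesis using difference_coloring_pos[OF c] by (simp add: f_def)
    next
      case 2
      obtain u v where uv: "e = {u, v}" using edge[OF 2(1)] by blast
      then show ?thesis using 2 fe[of u v] difference_coloring_edge(1)[OF c, of u v]
        by (auto simp: max_def min_def)
    qed
  next
    fix u v assume e: "{u, v} \<in> edges G"
    then have "u \<in> verts G" "v \<in> verts G" using G by (auto simp: simple_graph_def)
    then have pos: "0 < c u" "0 < c v" using difference_coloring_pos[OF c] by auto
    show "f (Inl u) \<noteq> f (Inl v)"
      using difference_coloring_edge[OF c e] by (simp add: f_def)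
    have "f (Inl u) = c u" by (simp add: f_def)
    then show "f (Inl u) \<noteq> f (Inr {u, v})"
      unfolding fe using pos difference_coloring_edge[OF c e] by (auto simp: max_def min_def)
  next
    fix u v w assume e: "{u, v} \<in> edges G \<and> {v, w} \<in> edges G \<and> {u, v} \<noteq> {v, w}"
    then have "u \<noteq> w" by (auto simp: insert_commute)
    then show "f (Inr {u, v}) \<noteq> f (Inr {v, w})"
      unfolding fe using e difference_coloring_path[OF c, of u v w]
        difference_coloring_edge(1)[OF c, of u v] difference_coloring_edge(1)[OF c, of v w]
      by (auto simp: max_def min_def)
  qed
  moreover have "int (f (Inr {u, v})) = \<bar>int (f (Inl u)) - int (f (Inl v))\<bar>" for u v
    unfolding fe by (auto simp: f_def)
  ultimately show ?thesis
    unfolding k_total_difference_labeling_def k_total_labeling_def by blast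
qed

text \<open>A lower bound on some vertex label is enough, because the maximum over vertices and
  edges dominates every vertex label.\<close>

lemma total_difference_chromatic_number_eqI:
  assumes G: "simple_graph G"
    and c: "difference_coloring G c" "k \<in> c ` verts G" "\<And>v. v \<in> verts G \<Longrightarrow> c v \<le> k"
    and lower: "\<And>d. difference_coloring G d \<Longrightarrow> \<exists>v\<in>verts G. k \<le> d v"
  shows "\<chi>\<^sub>t\<^sub>d G = k"
  unfolding total_difference_chromatic_number_def
proof (rule Least_equality)
  show "\<exists>f. k_total_difference_labeling k G f"
    using labeling_of_difference_coloring[OF G c] .
  fix k' assume "\<exists>f. k_total_difference_labeling k' G f"
  then obtain f where f: "k_total_difference_labeling k' G f" by blast
  obtain v where v: "v \<in> verts G" "k \<le> f (Inl v)"
    using lower[OF difference_coloring_of_labeling[OF f]] by auto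
  have "finite (verts G)" "edges G \<subseteq> Pow (verts G)"
    using G by (auto simp: simple_graph_def)
  then have "finite (f ` (verts G <+> edges G))"
    by (meson finite_Plus finite_Pow_iff finite_imageI finite_subset)
  moreover have "f (Inl v) \<in> f ` (verts G <+> edges G)" using v by auto
  ultimately have "f (Inl v) \<le> Max (f ` (verts G <+> edges G))" by simp
  also have "\<dots> = k'"
    using f by (simp add: k_total_difference_labeling_def k_total_labeling_def)
  finally show "k \<le> k'" using v by simp
qed

section \<open>Stars and the lower bound they share with wheels\<close>

lemma star_graph_edge_iff:
  "{u, v} \<in> edges (star_graph m) \<longleftrightarrow> (u < m \<and> v = m) \<or> (v < m \<and> u = m)"
  by (auto simp: star_graph_def doubleton_eq_iff)

lemma wheel_graph_edge_iff:
  "{u, v} \<in> edges (wheel_graph (Suc m)) \<longleftrightarrow>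
     (u < m \<and> v = (u + 1) mod m) \<or> (v < m \<and> u = (v + 1) mod m) \<or>
     (u < m \<and> v = m) \<or> (v < m \<and> u = m)"
  by (auto simp: wheel_graph_def cycle_graph_def doubleton_eq_iff)

lemma verts_star_graph: "verts (star_graph m) = {..m}"
  by (simp add: star_graph_def)

lemma verts_wheel_graph: "verts (wheel_graph (Suc m)) = {..m}"
  by (auto simp: wheel_graph_def cycle_graph_def)

text \<open>The star is a spanning subgraph of the wheel with the same centre, so lower bounds pass
  from stars to wheels.\<close>

lemma difference_coloring_star_of_wheel:
  assumes "difference_coloring (wheel_graph (Suc m)) c"
  shows "difference_coloring (star_graph m) c"
  using assms by (rule difference_coloring_mono)
    (auto simp: star_graph_def wheel_graph_def cycle_graph_def)

text \<open>Two vertices of a star are adjacent or both neighbours of the centre.\<close>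

lemma difference_coloring_star_inj:
  assumes c: "difference_coloring (star_graph m) c"
  shows "inj_on c {..m}"
proof (rule inj_onI, rule ccontr)
  fix u v assume uv: "u \<in> {..m}" "v \<in> {..m}" "c u = c v" "u \<noteq> v"
  show False
  proof (cases "u = m \<or> v = m")
    case True
    then show ?thesis using uv difference_coloring_edge(1)[OF c, of u v]
      by (auto simp: star_graph_edge_iff)
  next
    case False
    then show ?thesis using uv difference_coloring_path(1)[OF c, of u m v]
      by (auto simp: star_graph_edge_iff)
  qed
qed

text \<open>The bound is the least odd number not below the number \<open>Suc m\<close> of
  vertices.\<close>

lemma difference_coloring_star_lower:
  assumes m: "3 \<le> m" and c: "difference_coloring (star_graph m) c"
  shows "\<exists>v\<in>verts (star_graph m). 2 * (Suc m div 2) + 1 \<le> c v"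
proof (rule ccontr)
  assume "\<not> ?thesis"
  then have small: "c v \<le> 2 * (Suc m div 2)" if "v \<le> m" for v
    using that by (force simp: verts_star_graph)
  have inj: "inj_on c {..m}" by (rule difference_coloring_star_inj[OF c])
  have pos: "0 < c v" if "v \<le> m" for v
    using difference_coloring_pos[OF c] that by (simp add: verts_star_graph)
  have sub: "c ` {..m} \<subseteq> {1..2 * (Suc m div 2)}"
    using small pos by (force simp: Suc_le_eq)
  have card: "card (c ` {..m}) = Suc m" using card_image[OF inj] by simp
  \<comment> \<open>For odd \<open>Suc m\<close> this count is already contradictory; so
    \<open>Suc m\<close> is even and every label up to it occurs.\<close>
  then have "Suc m \<le> 2 * (Suc m div 2)" using card_mono[OF _ sub] by simp
  then have sz: "2 * (Suc m div 2) = Suc m" by linarith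
  then have all: "c ` {..m} = {1..Suc m}"
    using card_subset_eq[OF _ sub] card by simp
  have leaf: "\<exists>i<m. c i = y" if "1 \<le> y" "y \<le> Suc m" "y \<noteq> c m" for y
  proof -
    have "y \<in> c ` {..m}" using that all by simp
    then obtain i where "i \<le> m" "c i = y" by auto
    then show ?thesis using that by (metis le_neq_implies_less)
  qed
  have edge: "c i \<noteq> 2 * c m" "c m \<noteq> 2 * c i" if "i < m" for i
    using difference_coloring_edge[OF c, of i m] that by (auto simp: star_graph_edge_iff)
  consider "c m = 1" | "c m = Suc m" | "1 < c m" "c m < Suc m"
    using pos[of m] small[of m] sz by linarith
  then show False
  proof cases
    case 1
    then show ?thesis using leaf[of 2] edge m by auto
  next
    case 2
    then show ?thesis using leaf[of "Suc m div 2"] edge m sz by force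
  next
    case 3
    then have "1 \<le> c m - 1" "c m - 1 \<le> Suc m" "c m - 1 \<noteq> c m" by linarith+
    then obtain i where i: "i < m" "c i = c m - 1" using leaf by blast
    obtain j where j: "j < m" "c j = c m + 1" using leaf[of "c m + 1"] 3 by auto
    have "i \<noteq> j" using i j by auto
    then have "c i + c j \<noteq> 2 * c m"
      using difference_coloring_path(2)[OF c, of i m j] i j by (simp add: star_graph_edge_iff)
    then show ?thesis using i j 3 by simp
  qed
qed

lemma difference_coloring_wheel_lower:
  assumes "3 \<le> m" "difference_coloring (wheel_graph (Suc m)) c"
  shows "\<exists>v\<in>verts (wheel_graph (Suc m)). 2 * (Suc m div 2) + 1 \<le> c v"
  using difference_coloring_star_lower[OF assms(1) difference_coloring_star_of_wheel[OF assms(2)]]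
  by (simp add: verts_star_graph verts_wheel_graph)

text \<open>An odd hub label above all leaf labels is neither the double of one nor the mean of
  two.\<close>

lemma chromatic_number_star:
  assumes m: "3 \<le> m"
  shows "\<chi>\<^sub>t\<^sub>d (star_graph m) = 2 * (Suc m div 2) + 1"
proof (rule total_difference_chromatic_number_eqI)
  let ?h = "2 * (Suc m div 2) + 1"
  let ?c = "\<lambda>v. if v = m then ?h else Suc v"
  have h: "Suc m \<le> ?h" "odd ?h" by simp_all
  have "difference_coloring (star_graph m) (\<lambda>v. if v = m then h else Suc v)"
    if "Suc m \<le> h" "odd h" for h
    using that by (auto simp: difference_coloring_def star_graph_edge_iff verts_star_graph)
  then show "difference_coloring (star_graph m) ?c" using h by blast
  show "?h \<in> ?c ` verts (star_graph m)" by (auto simp: verts_star_graph)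
  show "?c v \<le> ?h" if "v \<in> verts (star_graph m)" for v
    using that h(1) by (auto simp: verts_star_graph)
qed (use simple_graph_star difference_coloring_star_lower[OF m] in auto)

section \<open>Colorings of wheels\<close>

text \<open>Symmetry reduces the checks to pairs \<open>i < j\<close> at the hub and to forward
  steps along the rim.\<close>

lemma difference_coloring_wheelI:
  assumes pos: "0 < h" "\<And>i. i < m \<Longrightarrow> 0 < g i"
    and inj: "inj_on g {..<m}"
    and hub: "\<And>i. i < m \<Longrightarrow> g i \<noteq> h \<and> g i \<noteq> 2 * h \<and> h \<noteq> 2 * g i"
    and hub_mid: "\<And>i j. i < j \<Longrightarrow> j < m \<Longrightarrow> g i + g j \<noteq> 2 * h"
    and rim: "\<And>i j. i < m \<Longrightarrow> j = (i + 1) mod m \<Longrightarrow>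
      g i \<noteq> 2 * g j \<and> g j \<noteq> 2 * g i \<and> g i + h \<noteq> 2 * g j \<and> g j + h \<noteq> 2 * g i"
    and rim3: "\<And>i j l. i < m \<Longrightarrow> j = (i + 1) mod m \<Longrightarrow> l = (j + 1) mod m \<Longrightarrow>
      g i + g l \<noteq> 2 * g j"
    and m: "3 \<le> m"
  shows "difference_coloring (wheel_graph (Suc m)) (\<lambda>v. if v = m then h else g v)"
proof -
  have next_lt: "(i + 1) mod m < m" for i using m by simp
  have next_ne: "i \<noteq> (i + 1) mod m" if "i < m" for i
    using that m by (cases "i + 1 = m") auto
  have next_inj: "i = j" if "i < m" "j < m" "(i + 1) mod m = (j + 1) mod m" for i j
    using that by (cases "i + 1 = m"; cases "j + 1 = m") auto
  have g_inj: "g i \<noteq> g j" if "i < m" "j < m" "i \<noteq> j" for i j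
    using inj that by (auto simp: inj_on_def)
  have hub_mid': "g i + g j \<noteq> 2 * h" if "i < m" "j < m" "i \<noteq> j" for i j
    using that hub_mid[of i j] hub_mid[of j i] by (cases "i < j") (auto simp: add.commute)
  let ?c = "\<lambda>v. if v = m then h else g v"
  let ?r = "\<lambda>u v. u < m \<and> v = (u + 1) mod m"
  have rim_lt: "u < m \<and> v < m" if "?r u v" for u v
    using that next_lt by blast
  show ?thesis
    unfolding difference_coloring_def
  proof (intro conjI allI impI ballI)
    fix v assume "v \<in> verts (wheel_graph (Suc m))"
    then show "0 < ?c v" using pos by (auto simp: verts_wheel_graph)
  next
    fix u v assume "{u, v} \<in> edges (wheel_graph (Suc m))"
    then consider "?r u v" | "?r v u" | "u < m" "v = m" | "v < m" "u = m"
      unfolding wheel_graph_edge_iff by blast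
    then have "?c u \<noteq> ?c v \<and> ?c u \<noteq> 2 * ?c v"
    proof cases
      case 1
      then show ?thesis using rim_lt[OF 1] next_ne[of u] rim[of u v] g_inj[of u v] by auto
    next
      case 2
      then show ?thesis using rim_lt[OF 2] next_ne[of v] rim[of v u] g_inj[of u v] by auto
    qed (use hub in auto)
    then show "?c u \<noteq> ?c v" "?c u \<noteq> 2 * ?c v" by blast+
  next
    fix u v w
    assume "{u, v} \<in> edges (wheel_graph (Suc m)) \<and> {v, w} \<in> edges (wheel_graph (Suc m)) \<and> u \<noteq> w"
    then have uv: "?r u v \<or> ?r v u \<or> u < m \<and> v = m \<or> v < m \<and> u = m"
      and vw: "?r v w \<or> ?r w v \<or> v < m \<and> w = m \<or> w < m \<and> v = m" and ne: "u \<noteq> w"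
      unfolding wheel_graph_edge_iff by blast+
    have "?c u \<noteq> ?c w \<and> ?c u + ?c w \<noteq> 2 * ?c v"
    proof (cases "v = m")
      case True
      then have "u < m" "w < m" using uv vw rim_lt by blast+
      then show ?thesis using True ne g_inj hub_mid' by auto
    next
      case False
      \<comment> \<open>Paths with a rim vertex \<open>v\<close> in the middle and the hub at one
        end.\<close>
      have mixed: "?c x \<noteq> ?c m \<and> ?c x + ?c m \<noteq> 2 * ?c v" if "?r x v \<or> ?r v x" for x
      proof -
        have "x < m" "v < m" using that rim_lt by blast+
        moreover have "g x + h \<noteq> 2 * g v" using that rim[of x v] rim[of v x] by blast
        ultimately show ?thesis using hub[of x] by auto
      qed
      from False have uv': "?r u v \<or> ?r v u \<or> u = m" and vw': "?r v w \<or> ?r w v \<or> w = m"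
        using uv vw by auto
      show ?thesis
      proof (cases "u = m \<or> w = m")
        case True
        then show ?thesis using mixed[of u] mixed[of w] uv' vw' ne by (metis add.commute)
      next
        case False
        \<comment> \<open>The path runs forwards, backwards, or folds at \<open>v\<close>; a fold
          gives \<open>u = w\<close>, as successors on the rim are unique and
          \<open>next_inj\<close> makes predecessors unique.\<close>
        then consider "?r u v" "?r v w" | "?r v u" "?r w v" | "?r u v" "?r w v" | "?r v u" "?r v w"
          using uv' vw' by blast
        moreover have "u < m" "v < m" "w < m" using False uv' vw' rim_lt by blast+
        then have c_eq: "u < m" "w < m" "?c u = g u" "?c v = g v" "?c w = g w" by simp_all
        ultimately show ?thesis
        proof cases
          case 1
          then have "g u + g w \<noteq> 2 * g v" using rim3 by blast
          then show ?thesis using c_eq g_inj ne by simp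
        next
          case 2
          then have "g w + g u \<noteq> 2 * g v" using rim3 by blast
          then show ?thesis using c_eq g_inj ne by (simp add: add.commute)
        next
          case 3
          then show ?thesis using next_inj ne by blast
        next
          case 4
          then show ?thesis using ne by blast
        qed
      qed
    qed
    then show "?c u \<noteq> ?c w" "?c u + ?c w \<noteq> 2 * ?c v" by blast+
  qed
qed

section \<open>Wheels with at least eight vertices\<close>

lemma chromatic_number_wheel_ge_8:
  assumes m: "7 \<le> m"
  shows "\<chi>\<^sub>t\<^sub>d (wheel_graph (Suc m)) = 2 * (Suc m div 2) + 1"
proof (rule total_difference_chromatic_number_eqI)
  define t where "t = Suc m div 2"
  \<comment> \<open>Even positions carry 1, 2, and so on; odd positions carry the high labels from
    \<open>t + 3\<close> to \<open>2 * t\<close>, then wrap round to \<open>t + 1\<close> and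
    \<open>t + 2\<close>.\<close>
  define g where "g i = (if even i then i div 2 + 1
    else if i div 2 + 2 < t then t + i div 2 + 3 else i div 2 + 3)" for i
  have t: "4 \<le> t" "m = 2 * t \<or> m + 1 = 2 * t" using m by (auto simp: t_def)
  have low: "i div 2 + 1 \<le> t" if "i < m" for i using that t by auto
  have g_even: "g i = i div 2 + 1" if "even i" for i using that by (simp add: g_def)
  have g_odd: "t < g i" if "i < m" "odd i" for i
    using that t by (auto simp: g_def elim!: oddE)
  have g_bd: "0 < g i" "g i \<le> 2 * t" if "i < m" for i
    using that t by (auto simp: g_def)
  have inj: "inj_on g {..<m}"
  proof (rule inj_onI)
    fix i j assume ij: "i \<in> {..<m}" "j \<in> {..<m}" "g i = g j"
    \<comment> \<open>Labels up to \<open>t\<close> sit exactly at the even positions, so a label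
      fixes the parity of its position.\<close>
    then have "even i = even j"
      using g_even[of i] g_even[of j] g_odd[of i] g_odd[of j] low[of i] low[of j] by fastforce
    moreover have "i div 2 = j div 2"
      using ij calculation t by (auto simp: g_def split: if_splits)
    ultimately show "i = j" by (metis bit_eq_rec)
  qed
  have succ: "j = (if i + 1 = m then 0 else i + 1)" if "i < m" "j = (i + 1) mod m" for i j
    using that by auto
  have "difference_coloring (wheel_graph (Suc m)) (\<lambda>v. if v = m then 2 * t + 1 else g v)"
  proof (rule difference_coloring_wheelI)
    \<comment> \<open>The hub label is odd and exceeds every rim label.\<close>
    show "g i \<noteq> 2 * t + 1 \<and> g i \<noteq> 2 * (2 * t + 1) \<and> 2 * t + 1 \<noteq> 2 * g i" if "i < m" for i
      using g_bd[OF that] by presburger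
    show "g i + g j \<noteq> 2 * (2 * t + 1)" if "i < j" "j < m" for i j
      using g_bd[of i] g_bd[of j] that by simp
    show "g i \<noteq> 2 * g j \<and> g j \<noteq> 2 * g i \<and> g i + (2 * t + 1) \<noteq> 2 * g j \<and>
      g j + (2 * t + 1) \<noteq> 2 * g i" if "i < m" "j = (i + 1) mod m" for i j
    proof -
      note ij = that
      consider "i + 1 = m" "j = 0" | "i + 1 < m" "j = i + 1"
        using succ[OF ij] ij(1) by (cases "i + 1 = m") auto
      then show ?thesis
      proof cases
        case 1
        then show ?thesis using t by (auto simp: g_def)
      next
        \<comment> \<open>A low label \<open>x\<close> and its high neighbour differ by
          \<open>t + 1\<close> or \<open>t + 2\<close>, or after the entry \<open>t - 1\<close> by 1
          or 2. A doubling would make \<open>x\<close> equal to this difference, which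
          \<open>x \<le> t\<close> and \<open>4 \<le> t\<close> exclude.\<close>
        case 2
        then show ?thesis using t by (cases "even i") (auto simp: g_def elim!: evenE oddE)
      qed
    qed
    show "g i + g l \<noteq> 2 * g j" if "i < m" "j = (i + 1) mod m" "l = (j + 1) mod m" for i j l
    proof -
      note ijl = that
      \<comment> \<open>For odd \<open>m\<close> the low labels \<open>t\<close> and 1 meet where
        the rim closes, so alternation fails there and the triples across the seam are separate
        cases.\<close>
      consider "i + 1 = m" "j = 0" "l = 1" | "i + 2 = m" "j = i + 1" "l = 0"
        | "i + 2 < m" "j = i + 1" "l = i + 2"
        using succ[OF ijl(1,2)] succ[of j l] ijl(1,3) m
        by (cases "i + 1 = m"; cases "i + 2 = m") auto
      then show ?thesis
      proof cases
        case 1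
        then show ?thesis using t by (auto simp: g_def)
      next
        case 2
        then show ?thesis using t by (auto simp: g_def)
      next
        case 3
        then show ?thesis using t by (cases "even i") (auto simp: g_def elim!: evenE oddE)
      qed
    qed
  qed (use g_bd inj m in auto)
  then show "difference_coloring (wheel_graph (Suc m))
      (\<lambda>v. if v = m then 2 * (Suc m div 2) + 1 else g v)"
    by (simp only: t_def)
  show "(if v = m then 2 * (Suc m div 2) + 1 else g v) \<le> 2 * (Suc m div 2) + 1"
    if "v \<in> verts (wheel_graph (Suc m))" for v
    using that g_bd(2)[of v] by (auto simp: verts_wheel_graph t_def)
qed (use m simple_graph_wheel difference_coloring_wheel_lower in \<open>auto simp: verts_wheel_graph\<close>)

section \<open>Wheels with at most seven vertices\<close>

text \<open>These are the constraints on the labels of a triangle; the hub and any rim edge form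
  one.\<close>

definition triad :: "nat \<Rightarrow> nat \<Rightarrow> nat \<Rightarrow> bool" where
  "triad x y z \<longleftrightarrow> x \<noteq> y \<and> x \<noteq> z \<and> y \<noteq> z \<and>
     x \<noteq> 2 * y \<and> y \<noteq> 2 * x \<and> x \<noteq> 2 * z \<and> z \<noteq> 2 * x \<and> y \<noteq> 2 * z \<and> z \<noteq> 2 * y \<and>
     x + y \<noteq> 2 * z \<and> x + z \<noteq> 2 * y \<and> y + z \<noteq> 2 * x"

lemma difference_coloring_triangle:
  assumes c: "difference_coloring G c"
    and e: "{u, v} \<in> edges G" "{v, w} \<in> edges G" "{u, w} \<in> edges G"
  shows "triad (c u) (c v) (c w)"
proof -
  have e': "{v, u} \<in> edges G" "{w, v} \<in> edges G" "{w, u} \<in> edges G"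
    using e by (simp_all add: insert_commute)
  have E: "c u \<noteq> c v" "c v \<noteq> c w" "c u \<noteq> c w"
    using difference_coloring_edge(1)[OF c] e by auto
  then have "u \<noteq> v" "v \<noteq> w" "u \<noteq> w" by auto
  then have "c u + c v \<noteq> 2 * c w" "c u + c w \<noteq> 2 * c v" "c v + c w \<noteq> 2 * c u"
    using difference_coloring_path(2)[OF c] e e' by blast+
  then show ?thesis
    using E difference_coloring_edge(2,3)[OF c] e unfolding triad_def by blast
qed

text \<open>With \<open>if\<close> in place of \<open>\<longrightarrow>\<close> the evaluation skips the inner quantifiers of failed branches.\<close>

lemma no_tetrahedron_below_8:
  "\<forall>h\<in>set [1..<8]. \<forall>x\<in>set [1..<8]. \<forall>y\<in>set [1..<8]. if triad h x y then
     (\<forall>z\<in>set [1..<8]. if triad h y z then if triad h z x then \<not> triad x y z else True else True)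
   else True"
  by code_simp

text \<open>Opposite rim vertices share the hub as a neighbour, so both \<open>x = z\<close> and
  \<open>y = w\<close> are impossible in a coloring of the wheel on five vertices.\<close>

lemma no_square_pyramid_below_7:
  "\<forall>h\<in>set [1..<7]. \<forall>x\<in>set [1..<7]. \<forall>y\<in>set [1..<7]. if triad h x y then
     (\<forall>z\<in>set [1..<7]. if triad h y z then if x = z then True else
       (\<forall>w\<in>set [1..<7]. if triad h z w then if triad h w x then y = w else True else True)
     else True)
   else True"
  by code_simp

text \<open>With the rim as a list and all quantifiers bounded, a concrete coloring is checked by
  evaluation; only the lower bound is left to argue.\<close>

lemma chromatic_number_wheel_list:
  assumes m: "m = length xs" "3 \<le> m" and dist: "distinct (h # xs)" and pos: "0 \<notin> set (h # xs)"
    and hub: "\<forall>x\<in>set xs. x \<noteq> 2 * h \<and> h \<noteq> 2 * x"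
    and hub_mid: "\<forall>x\<in>set xs. \<forall>y\<in>set xs. x \<noteq> y \<longrightarrow> x + y \<noteq> 2 * h"
    and rim: "\<forall>i\<in>set [0..<m].
      xs ! i \<noteq> 2 * xs ! ((i + 1) mod m) \<and> xs ! ((i + 1) mod m) \<noteq> 2 * xs ! i \<and>
      xs ! i + h \<noteq> 2 * xs ! ((i + 1) mod m) \<and> xs ! ((i + 1) mod m) + h \<noteq> 2 * xs ! i"
    and rim3: "\<forall>i\<in>set [0..<m].
      xs ! i + xs ! (((i + 1) mod m + 1) mod m) \<noteq> 2 * xs ! ((i + 1) mod m)"
    and max: "k \<in> set (h # xs)" "\<forall>x\<in>set (h # xs). x \<le> k"
    and lower: "\<And>d. difference_coloring (wheel_graph (Suc m)) d \<Longrightarrow>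
      \<exists>v\<in>verts (wheel_graph (Suc m)). k \<le> d v"
  shows "\<chi>\<^sub>t\<^sub>d (wheel_graph (Suc m)) = k"
proof (rule total_difference_chromatic_number_eqI)
  let ?c = "\<lambda>v. if v = m then h else xs ! v"
  show "difference_coloring (wheel_graph (Suc m)) ?c"
  proof (rule difference_coloring_wheelI)
    show "inj_on ((!) xs) {..<m}"
      using dist m by (simp add: inj_on_nth)
    show "0 < xs ! i" if "i < m" for i
      using pos that m by (metis gr0I list.set_intros(2) nth_mem)
    show "xs ! i \<noteq> h \<and> xs ! i \<noteq> 2 * h \<and> h \<noteq> 2 * xs ! i" if "i < m" for i
      using dist hub that m nth_mem by fastforce
    show "xs ! i + xs ! j \<noteq> 2 * h" if "i < j" "j < m" for i j
      using dist hub_mid that m by (auto simp: nth_eq_iff_index_eq)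
  qed (use pos m rim rim3 in auto)
  have "xs ! v \<in> set xs" if "v < m" for v using that m by simp
  then show "?c v \<le> k" if "v \<in> verts (wheel_graph (Suc m))" for v
    using that max(2) by (auto simp: verts_wheel_graph)
  show "k \<in> ?c ` verts (wheel_graph (Suc m))"
  proof (cases "k = h")
    case False
    then obtain i where "i < m" "xs ! i = k" using max(1) m by (auto simp: in_set_conv_nth)
    then show ?thesis by (auto simp: verts_wheel_graph image_iff intro!: bexI[of _ i])
  qed (auto simp: verts_wheel_graph)
qed (use m simple_graph_wheel lower in auto)

text \<open>For six and seven vertices \<open>t\<close> would be 3 and the general pattern would put
  2 beside 4; explicit colorings attain the star bound 7 instead.\<close>

lemma chromatic_number_wheel_6: "\<chi>\<^sub>t\<^sub>d (wheel_graph (Suc 5)) = 7"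
proof (rule chromatic_number_wheel_list[where h = 1 and xs = "[3, 4, 6, 5, 7]"])
  fix d assume "difference_coloring (wheel_graph (Suc 5)) d"
  then show "\<exists>v\<in>verts (wheel_graph (Suc 5)). 7 \<le> d v"
    using difference_coloring_wheel_lower[of 5 d] by simp
qed code_simp+

lemma chromatic_number_wheel_7: "\<chi>\<^sub>t\<^sub>d (wheel_graph (Suc 6)) = 7"
proof (rule chromatic_number_wheel_list[where h = 7 and xs = "[1, 6, 4, 5, 2, 3]"])
  fix d assume "difference_coloring (wheel_graph (Suc 6)) d"
  then show "\<exists>v\<in>verts (wheel_graph (Suc 6)). 7 \<le> d v"
    using difference_coloring_wheel_lower[of 6 d] by simp
qed code_simp+

text \<open>This wheel is the complete graph on four vertices, and its four triangles force more
  than the star bound 5.\<close>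

lemma chromatic_number_wheel_4: "\<chi>\<^sub>t\<^sub>d (wheel_graph (Suc 3)) = 8"
proof (rule chromatic_number_wheel_list[where h = 8 and xs = "[1, 5, 7]"])
  fix d assume d: "difference_coloring (wheel_graph (Suc 3)) d"
  show "\<exists>v\<in>verts (wheel_graph (Suc 3)). 8 \<le> d v"
  proof (rule ccontr)
    assume "\<not> ?thesis"
    then have "d v \<in> set [1..<8]" if "v \<le> 3" for v
      using that difference_coloring_pos[OF d, of v] unfolding verts_wheel_graph by force
    then have "d 0 \<in> set [1..<8]" "d 1 \<in> set [1..<8]" "d 2 \<in> set [1..<8]" "d 3 \<in> set [1..<8]"
      by simp_all
    moreover have "triad (d 3) (d 0) (d 1)" "triad (d 3) (d 1) (d 2)" "triad (d 3) (d 2) (d 0)"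
        "triad (d 0) (d 1) (d 2)"
      by (rule difference_coloring_triangle[OF d]; simp only: wheel_graph_edge_iff; simp)+
    ultimately show False
      using bspec[OF bspec[OF bspec[OF no_tetrahedron_below_8]], of "d 3" "d 0" "d 1"]
      by (metis (full_types))
  qed
qed code_simp+

lemma chromatic_number_wheel_5: "\<chi>\<^sub>t\<^sub>d (wheel_graph (Suc 4)) = 7"
proof (rule chromatic_number_wheel_list[where h = 7 and xs = "[3, 1, 5, 2]"])
  fix d assume d: "difference_coloring (wheel_graph (Suc 4)) d"
  show "\<exists>v\<in>verts (wheel_graph (Suc 4)). 7 \<le> d v"
  proof (rule ccontr)
    assume "\<not> ?thesis"
    then have "d v \<in> set [1..<7]" if "v \<le> 4" for v
      using that difference_coloring_pos[OF d, of v] unfolding verts_wheel_graph by force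
    then have "d 0 \<in> set [1..<7]" "d 1 \<in> set [1..<7]" "d 2 \<in> set [1..<7]" "d 3 \<in> set [1..<7]"
        "d 4 \<in> set [1..<7]"
      by simp_all
    moreover have "triad (d 4) (d 0) (d 1)" "triad (d 4) (d 1) (d 2)" "triad (d 4) (d 2) (d 3)"
        "triad (d 4) (d 3) (d 0)"
      by (rule difference_coloring_triangle[OF d]; simp only: wheel_graph_edge_iff; simp)+
    \<comment> \<open>The paths run through the hub, vertex 4.\<close>
    moreover have "d 0 \<noteq> d 2" "d 1 \<noteq> d 3"
      by (rule difference_coloring_path(1)[OF d, of _ 4]; (simp only: wheel_graph_edge_iff)?; simp)+
    ultimately show False
      using bspec[OF bspec[OF bspec[OF no_square_pyramid_below_7]], of "d 4" "d 0" "d 1"]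
      by (metis (full_types))
  qed
qed code_simp+

theorem theorem5p1:
  fixes n :: nat
  assumes "n \<ge> 4"
  shows "(\<chi>\<^sub>t\<^sub>d (wheel_graph n) = \<chi>\<^sub>t\<^sub>d (star_graph (n - 1)) \<longleftrightarrow> n \<noteq> 4 \<and> n \<noteq> 5) \<and>
    \<chi>\<^sub>t\<^sub>d (wheel_graph n) =
      (if n = 4 then 8 else if n = 5 then 7 else if even n then n + 1 else n)"
proof -
  \<comment> \<open>This value is \<open>n + 1\<close> for even \<open>n\<close> and
    \<open>n\<close> for odd \<open>n\<close>; it is 5 for both exceptions, below the wheel values 8
    and 7.\<close>
  have star: "\<chi>\<^sub>t\<^sub>d (star_graph (n - 1)) = 2 * (n div 2) + 1"
    using chromatic_number_star[of "n - 1"] assms by simp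
  consider "n = 4" | "n = 5" | "n = 6" | "n = 7" | "8 \<le> n" using assms by linarith
  then show ?thesis
  proof cases
    case 5
    then have "\<chi>\<^sub>t\<^sub>d (wheel_graph n) = 2 * (n div 2) + 1"
      using chromatic_number_wheel_ge_8[of "n - 1"] by simp
    then show ?thesis using star 5 by auto
  qed (use star chromatic_number_wheel_4 chromatic_number_wheel_5 chromatic_number_wheel_6
      chromatic_number_wheel_7 in auto)
qed

end
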